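(* Let $m\ge 4$ be an integer and let $G$ be an isolate-free graph with exactly $m$ edges. (i) Suppose $m\le 8$ and put $t=\lfloor m/3\rfloor$. Let $\theta(m)$ be the largest root of the equation $$x^3-x^2+(t-m)x+m-3t=0,$$ and let $G_m=K_1\vee tK_2$ if $m=6$, and $G_m=K_1\vee (tK_2\cup (m-3t)K_1)$ if $m\in\{4,5,7,8\}$. If $\rho(G)\ge \theta(m)$, then $G$ contains a chorded cycle unless $G\cong G_m$. (ii) Suppose $m\ge 9$. If $\rho(G)\ge \sqrt{m}$, then $G$ contains a chorded cycle unless one of the following holds: - $m=9$ and $G$ is isomorphic to one of $K_1\vee 3K_2$, $K_1\vee (2K_2\cup 3K_1)$, $K_1\vee (K_2\cup 6K_1)$, $K_{1,9}$; - $m\ge 10$ and $G\cong K_{1,m}$, or $m\ge 10$ is even and $G\cong K_{2,m/2}$.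
   Context: All graphs are finite and simple. A graph is isolate-free if it has no isolated vertices (it need not be connected, and its number of vertices is not fixed). The size of a graph is its number of edges. $\rho(G)$ denotes the spectral radius of $G$, i.e. the largest eigenvalue of the adjacency matrix of $G$. A chord of a cycle $C$ in $G$ is an edge of $G$ that joins two vertices of $C$ and is not itself an edge of $C$. A chorded cycle is a cycle with at least one chord; "$G$ contains a chorded cycle" means that some cycle in $G$ (as a subgraph) has at least one chord in $G$. $G\cup H$ denotes the disjoint union of graphs $G$ and $H$; $kG$ denotes the disjoint union of $k$ copies of $G$; $G\vee H$ denotes the join, obtained from $G\cup H$ by adding all edges between vertices of $G$ and vertices of $H$. $K_n$ is the complete graph on $n$ vertices and $K_{a,b}$ is the complete bipartite graph with classes of sizes $a$ and $b$. *)

theory Defs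
  imports Complex_Main "Jordan_Normal_Form.Char_Poly"
begin

record 'a sgraph =
  verts :: "'a set"
  edges :: "'a set set"

definition simple_graph :: "'a sgraph \<Rightarrow> bool" where
  "simple_graph G \<longleftrightarrow> finite (verts G) \<and> (\<forall>e\<in>edges G. e \<subseteq> verts G \<and> card e = 2)"

definition isolate_free :: "'a sgraph \<Rightarrow> bool" where
  "isolate_free G \<longleftrightarrow> (\<forall>v\<in>verts G. \<exists>e\<in>edges G. v \<in> e)"

text \<open>The eigenvalues of the adjacency matrix do not depend on the chosen enumeration of the
  vertices.\<close>

definition vertex_enum :: "'a sgraph \<Rightarrow> 'a list" where
  "vertex_enum G = (SOME vs. distinct vs \<and> set vs = verts G)"

definition adjacency_matrix :: "'a sgraph \<Rightarrow> real mat" where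
  "adjacency_matrix G = (let vs = vertex_enum G in
     mat (length vs) (length vs) (\<lambda>(i, j). if {vs ! i, vs ! j} \<in> edges G then 1 else 0))"

text \<open>The adjacency matrix is real symmetric, so all its eigenvalues are real.  The value of
  \<open>rho\<close> is unspecified for the graph without vertices.\<close>

definition rho :: "'a sgraph \<Rightarrow> real" where
  "rho G = Max {x. eigenvalue (adjacency_matrix G) x}"

text \<open>A cycle is given by the list of its vertices in cyclic order.\<close>

definition cycle_edges :: "'a list \<Rightarrow> 'a set set" where
  "cycle_edges c = {{c ! i, c ! (Suc i mod length c)} | i. i < length c}"

definition is_cycle :: "'a sgraph \<Rightarrow> 'a list \<Rightarrow> bool" where
  "is_cycle G c \<longleftrightarrow> length c \<ge> 3 \<and> distinct c \<and> set c \<subseteq> verts G \<and> cycle_edges c \<subseteq> edges G"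

definition is_chord :: "'a sgraph \<Rightarrow> 'a list \<Rightarrow> 'a set \<Rightarrow> bool" where
  "is_chord G c e \<longleftrightarrow> e \<in> edges G \<and> e \<subseteq> set c \<and> e \<notin> cycle_edges c"

definition contains_chorded_cycle :: "'a sgraph \<Rightarrow> bool" where
  "contains_chorded_cycle G \<longleftrightarrow> (\<exists>c. is_cycle G c \<and> (\<exists>e. is_chord G c e))"

definition graph_iso :: "'a sgraph \<Rightarrow> 'b sgraph \<Rightarrow> bool" (infix \<open>\<simeq>\<close> 50) where
  "G \<simeq> H \<longleftrightarrow> (\<exists>f. bij_betw f (verts G) (verts H) \<and>
     (\<forall>u\<in>verts G. \<forall>v\<in>verts G. {u, v} \<in> edges G \<longleftrightarrow> {f u, f v} \<in> edges H))"

definition complete_graph :: "nat \<Rightarrow> nat sgraph" where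
  "complete_graph n = \<lparr>verts = {..<n}, edges = {e. e \<subseteq> {..<n} \<and> card e = 2}\<rparr>"

definition complete_bipartite :: "nat \<Rightarrow> nat \<Rightarrow> (nat + nat) sgraph" where
  "complete_bipartite a b = \<lparr>verts = {..<a} <+> {..<b},
     edges = {{Inl i, Inr j} | i j. i < a \<and> j < b}\<rparr>"

definition disjoint_union :: "'a sgraph \<Rightarrow> 'b sgraph \<Rightarrow> ('a + 'b) sgraph" where
  "disjoint_union G H = \<lparr>verts = verts G <+> verts H,
     edges = {Inl ` e | e. e \<in> edges G} \<union> {Inr ` e | e. e \<in> edges H}\<rparr>"

definition copies :: "nat \<Rightarrow> 'a sgraph \<Rightarrow> (nat \<times> 'a) sgraph" where
  "copies k G = \<lparr>verts = {..<k} \<times> verts G,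
     edges = {Pair i ` e | i e. i < k \<and> e \<in> edges G}\<rparr>"

definition graph_join :: "'a sgraph \<Rightarrow> 'b sgraph \<Rightarrow> ('a + 'b) sgraph" where
  "graph_join G H = \<lparr>verts = verts (disjoint_union G H),
     edges = edges (disjoint_union G H) \<union> {{Inl u, Inr v} | u v. u \<in> verts G \<and> v \<in> verts H}\<rparr>"

definition theta :: "nat \<Rightarrow> real" where
  "theta m = (let t = real (m div 3) in
     Max {x. x ^ 3 - x ^ 2 + (t - real m) * x + real m - 3 * t = 0})"

end

theory Submission
  imports Defs "Jordan_Normal_Form.Spectral_Radius"
begin

text \<open>Let \<open>r = \<rho>(G)\<close> and let \<open>x\<close> be the entrywise absolute value of an eigenvector, scaled so that its
  maximum is \<open>x u = 1\<close>; then \<open>r x \<le> A x\<close> for the adjacency matrix \<open>A\<close>, and no Perron--Frobenius theory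
  is needed.  Without chorded cycles, \<open>G\<close> induces a matching with \<open>t\<close> edges on the neighbourhood \<open>N\<close> of
  \<open>u\<close>, and a vertex at distance two from \<open>u\<close> that is adjacent to a matched vertex has no other neighbour
  in \<open>N\<close>.  Applying \<open>A\<close> twice at \<open>u\<close> and charging every excess contribution to edges outside the
  closed neighbourhood of \<open>u\<close> yields \<open>(r - 1)(r\<^sup>2 - m) \<le> t (3 - r)\<close>.  Equality forces every vertex
  outside the closed neighbourhood to have neighbourhood exactly \<open>N\<close>, and forbids such vertices if
  \<open>t \<ge> 1\<close>; so \<open>G\<close> is complete bipartite or \<open>K\<^sub>1 \<or> (t K\<^sub>2 \<union> (m - 3 t) K\<^sub>1)\<close>.  For \<open>m \<ge> 9\<close> one has
  \<open>r \<ge> 3\<close>, so both sides vanish.  For \<open>m \<le> 8\<close>, the polynomial defining \<open>\<theta>(m)\<close> is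
  \<open>(x - 1)(x\<^sup>2 - m) - \<lfloor>m/3\<rfloor>(3 - x)\<close>, which is nonnegative at \<open>r \<ge> \<theta>(m)\<close>; since \<open>3 t \<le> m\<close>, again
  equality holds.\<close>

section \<open>The spectral radius\<close>

text \<open>\<open>rho\<close> is a \<open>Max\<close> over real eigenvalues, so that set must be
  shown nonempty. A complex eigenpair (k, v) exists; by symmetry the Hermitian form at v is real,
  and it equals k times the positive squared norm of v, so k is real.\<close>

lemma real_symmetric_eigenvalue_exists:
  fixes A :: "real mat"
  assumes A: "A \<in> carrier_mat n n" and n: "n > 0"
    and sym: "\<And>i j. i < n \<Longrightarrow> j < n \<Longrightarrow> A $$ (i, j) = A $$ (j, i)"
  shows "\<exists>k. eigenvalue A k"
proof -
  define B where "B = map_mat complex_of_real A"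
  have B: "B \<in> carrier_mat n n" using A by (simp add: B_def)
  from spectrum_non_empty[OF B n] obtain k v where "eigenvector B v k"
    by (auto simp: spectrum_def eigenvalue_def)
  then have v: "v \<in> carrier_vec n" "v \<noteq> 0\<^sub>v n" "B *\<^sub>v v = k \<cdot>\<^sub>v v"
    using B by (auto simp: eigenvector_def)
  have row: "(\<Sum>j<n. complex_of_real (A $$ (i, j)) * v $ j) = k * v $ i" if "i < n" for i
  proof -
    have "(B *\<^sub>v v) $ i = (\<Sum>j<n. complex_of_real (A $$ (i, j)) * v $ j)"
      using that A v(1) by (auto simp: B_def scalar_prod_def lessThan_atLeast0)
    then show ?thesis using v that by simp
  qed
  define q where "q = (\<Sum>i<n. \<Sum>j<n. cnj (v $ i) * (complex_of_real (A $$ (i, j)) * v $ j))"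
  have q: "q = k * complex_of_real (\<Sum>i<n. (cmod (v $ i))\<^sup>2)"
  proof -
    have "q = (\<Sum>i<n. cnj (v $ i) * (k * v $ i))"
      unfolding q_def by (intro sum.cong refl) (simp flip: sum_distrib_left add: row)
    also have "\<dots> = (\<Sum>i<n. k * complex_of_real ((cmod (v $ i))\<^sup>2))"
      by (intro sum.cong refl) (simp add: complex_norm_square mult_ac flip: of_real_power)
    finally show ?thesis by (simp add: sum_distrib_left)
  qed
  have "cnj q = (\<Sum>i<n. \<Sum>j<n. v $ i * (complex_of_real (A $$ (i, j)) * cnj (v $ j)))"
    by (simp add: q_def)
  also have "\<dots> = (\<Sum>j<n. \<Sum>i<n. v $ i * (complex_of_real (A $$ (i, j)) * cnj (v $ j)))"
    by (rule sum.swap)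
  also have "\<dots> = q" unfolding q_def
    by (intro sum.cong refl) (auto simp: sym mult_ac)
  finally have "Im q = 0" by (simp add: complex_eq_iff)
  obtain i0 where i0: "i0 < n" "v $ i0 \<noteq> 0"
    using v(1,2) by (metis carrier_vecD eq_vecI index_zero_vec(1) index_zero_vec(2))
  have "(\<Sum>i<n. (cmod (v $ i))\<^sup>2) > 0"
    using i0 by (intro sum_pos2[of _ i0]) auto
  with \<open>Im q = 0\<close> q have "Im k = 0" by simp
  then have k: "k = complex_of_real (Re k)" by (simp add: complex_eq_iff)
  \<comment> \<open>As A and k are real, the real and the imaginary part of v each satisfy the
    eigenvector equation, and one of them is nonzero at \<open>i0\<close>.\<close>
  define part where "part f = vec n (\<lambda>i. f (v $ i))" for f :: "complex \<Rightarrow> real"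
  have part: "A *\<^sub>v part f = Re k \<cdot>\<^sub>v part f" if "f = Re \<or> f = Im" for f
  proof (rule eq_vecI)
    fix i assume "i < dim_vec (Re k \<cdot>\<^sub>v part f)"
    then have i: "i < n" by (simp add: part_def)
    have "(A *\<^sub>v part f) $ i = (\<Sum>j<n. A $$ (i, j) * f (v $ j))"
      using i A by (auto simp: part_def scalar_prod_def lessThan_atLeast0)
    also have "\<dots> = f (\<Sum>j<n. complex_of_real (A $$ (i, j)) * v $ j)"
      using that by auto
    also have "\<dots> = f (complex_of_real (Re k) * v $ i)" using row[OF i] k by simp
    also have "\<dots> = (Re k \<cdot>\<^sub>v part f) $ i" using that i by (auto simp: part_def)
    finally show "(A *\<^sub>v part f) $ i = (Re k \<cdot>\<^sub>v part f) $ i" .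
  qed (use A in \<open>auto simp: part_def\<close>)
  obtain f where f: "f = Re \<or> f = Im" "f (v $ i0) \<noteq> 0"
    using i0(2) by (auto simp: complex_eq_iff)
  have "part f \<noteq> 0\<^sub>v n"
  proof
    assume "part f = 0\<^sub>v n"
    then have "part f $ i0 = 0\<^sub>v n $ i0" by simp
    with f i0 show False by (simp add: part_def)
  qed
  then have "eigenvector A (part f) (Re k)"
    using part[OF f(1)] A by (simp add: eigenvector_def) (simp add: part_def)
  then show ?thesis by (auto simp: eigenvalue_def)
qed

text \<open>Absolute values of an eigenvector for \<open>rho G\<close>: the entries of the matrix
  are nonnegative, so the triangle inequality turns the eigenvalue equation into an
  inequality.\<close>

lemma rho_subinvariant_vector:
  assumes G: "simple_graph G" and ne: "verts G \<noteq> {}"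
  shows "\<exists>y. (\<forall>v. 0 \<le> y v) \<and> (\<exists>v\<in>verts G. y v \<noteq> 0) \<and>
    (\<forall>v\<in>verts G. rho G * y v \<le> (\<Sum>w\<in>verts G. of_bool ({v, w} \<in> edges G) * y w))"
proof -
  have fin: "finite (verts G)" using G by (simp add: simple_graph_def)
  define vs where "vs = vertex_enum G"
  have "distinct vs \<and> set vs = verts G"
    unfolding vs_def vertex_enum_def by (rule someI_ex) (metis finite_distinct_list fin)
  then have vs: "distinct vs" "set vs = verts G" by auto
  define n where "n = length vs"
  have n: "n > 0" using vs ne by (auto simp: n_def)
  define A where "A = adjacency_matrix G"
  have Aeq: "A = mat n n (\<lambda>(i, j). if {vs ! i, vs ! j} \<in> edges G then 1 else 0)"
    by (simp add: A_def adjacency_matrix_def vs_def n_def Let_def)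
  have A: "A \<in> carrier_mat n n" by (simp add: Aeq)
  have "\<exists>k. eigenvalue A k"
    by (rule real_symmetric_eigenvalue_exists[OF A n]) (simp add: Aeq insert_commute)
  moreover have "finite {x. eigenvalue A x}"
    using card_finite_spectrum(1)[OF A] by (simp add: spectrum_def)
  ultimately have "eigenvalue A (rho G)"
    using Max_in[of "{x. eigenvalue A x}"] by (auto simp: rho_def A_def)
  then obtain x where x: "x \<in> carrier_vec n" "x \<noteq> 0\<^sub>v n" "A *\<^sub>v x = rho G \<cdot>\<^sub>v x"
    using A by (auto simp: eigenvalue_def eigenvector_def)
  have bij: "bij_betw ((!) vs) {..<n} (verts G)"
    using vs by (simp add: bij_betw_nth n_def)
  \<comment> \<open>The inverse of the enumeration carries coordinates over to vertices, so the
    matrix does not occur in later arguments.\<close>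
  define y where "y v = \<bar>x $ (the_inv_into {..<n} ((!) vs) v)\<bar>" for v
  have y: "y (vs ! i) = \<bar>x $ i\<bar>" if "i < n" for i
    using that bij by (simp add: y_def the_inv_into_f_f bij_betw_def)
  have "rho G * y v \<le> (\<Sum>w\<in>verts G. of_bool ({v, w} \<in> edges G) * y w)" if v: "v \<in> verts G" for v
  proof -
    obtain i where i: "i < n" "v = vs ! i"
      using v vs(2) unfolding n_def by (metis in_set_conv_nth)
    have "rho G * x $ i = (A *\<^sub>v x) $ i" using x i by simp
    also have "\<dots> = (\<Sum>j<n. A $$ (i, j) * x $ j)"
      using i x(1) A by (auto simp: scalar_prod_def lessThan_atLeast0)
    also have "\<dots> = (\<Sum>j<n. of_bool ({v, vs ! j} \<in> edges G) * x $ j)"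
      using i by (intro sum.cong refl) (simp add: Aeq)
    finally have "rho G * \<bar>x $ i\<bar> \<le> \<bar>\<Sum>j<n. of_bool ({v, vs ! j} \<in> edges G) * x $ j\<bar>"
      by (metis abs_ge_self abs_mult abs_ge_zero mult_right_mono)
    also have "\<dots> \<le> (\<Sum>j<n. of_bool ({v, vs ! j} \<in> edges G) * \<bar>x $ j\<bar>)"
      by (rule order_trans[OF sum_abs]) (simp add: abs_mult)
    also have "\<dots> = (\<Sum>j<n. of_bool ({v, vs ! j} \<in> edges G) * y (vs ! j))"
      by (simp add: y)
    also have "\<dots> = (\<Sum>w\<in>verts G. of_bool ({v, w} \<in> edges G) * y w)"
      by (rule sum.reindex_bij_betw[OF bij])
    finally show ?thesis using i y by simp
  qed
  moreover obtain i where "i < n" "x $ i \<noteq> 0"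
    using x(1,2) by (metis carrier_vecD eq_vecI index_zero_vec(1) index_zero_vec(2))
  then have "\<exists>v\<in>verts G. y v \<noteq> 0"
    using y bij by (metis abs_eq_0 bij_betwE lessThan_iff)
  ultimately show ?thesis by (intro exI[of _ y]) (auto simp: y_def)
qed

text \<open>The cubic is monic, so a negative value at c leaves a root beyond c. Concrete c give
  lower bounds for \<open>theta m\<close>; contrapositively, the cubic is nonnegative from
  \<open>theta m\<close> onwards.\<close>

lemma less_theta:
  fixes c :: real
  assumes "c ^ 3 - c\<^sup>2 + (real (m div 3) - real m) * c + real m - 3 * real (m div 3) < 0"
  shows "c < theta m"
proof -
  define t where "t = real (m div 3)"
  define p where "p = [:real m - 3 * t, t - real m, -1, 1:]"
  have p: "poly p x = x ^ 3 - x\<^sup>2 + (t - real m) * x + real m - 3 * t" for x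
    by (simp add: p_def algebra_simps power2_eq_square power3_eq_cube)
  have fin: "finite {x. poly p x = 0}"
    by (rule poly_roots_finite) (simp add: p_def)
  have "poly p c < 0" using assms by (simp add: p t_def)
  moreover have lc: "lead_coeff p = 1" by (simp add: p_def)
  then have "\<exists>n. \<forall>x\<ge>n. 1 \<le> poly p x"
    using poly_pinfty_gt_lc[of p] by simp
  then obtain n where "\<forall>x\<ge>n. 1 \<le> poly p x" ..
  then have "poly p (max c n + 1) \<ge> 1" by (simp add: max_def)
  then have "poly p (max c n + 1) > 0" by linarith
  moreover have "c < max c n + 1" by linarith
  ultimately obtain x where "c < x" "poly p x = 0"
    using poly_IVT_pos[of c "max c n + 1" p] by auto
  then have "c < Max {x. poly p x = 0}"
    using Max_ge[OF fin, of x] by auto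
  then show ?thesis by (simp add: theta_def p t_def Let_def)
qed

section \<open>Graphs without chorded cycles\<close>

lemma cycle_edges_image: "cycle_edges c = (\<lambda>i. {c ! i, c ! (Suc i mod length c)}) ` {..<length c}"
  by (auto simp: cycle_edges_def)

lemma cycle_edges_4: "cycle_edges [a, b, c, d] = {{a, b}, {b, c}, {c, d}, {d, a}}"
  by (auto simp: cycle_edges_image lessThan_Suc)

lemma cycle_edges_5: "cycle_edges [a, b, c, d, e] = {{a, b}, {b, c}, {c, d}, {d, e}, {e, a}}"
  by (auto simp: cycle_edges_image lessThan_Suc)

lemma cycle_edges_6:
  "cycle_edges [a, b, c, d, e, f] = {{a, b}, {b, c}, {c, d}, {d, e}, {e, f}, {f, a}}"
  by (auto simp: cycle_edges_image lessThan_Suc)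

locale chordless_graph =
  fixes G :: "'a sgraph"
  assumes simple: "simple_graph G" and chordless: "\<not> contains_chorded_cycle G"
begin

abbreviation V where "V \<equiv> verts G"

definition adj :: "'a \<Rightarrow> 'a \<Rightarrow> bool" where "adj v w \<longleftrightarrow> {v, w} \<in> edges G"

abbreviation a :: "'a \<Rightarrow> 'a \<Rightarrow> real" where "a v w \<equiv> of_bool (adj v w)"

lemma finite_V: "finite V"
  using simple by (simp add: simple_graph_def)

lemma adj_commute: "adj v w \<longleftrightarrow> adj w v"
  by (simp add: adj_def insert_commute)

lemma adj_V: "adj v w \<Longrightarrow> v \<in> V" "adj v w \<Longrightarrow> w \<in> V"
  using simple by (auto simp: adj_def simple_graph_def)

lemma adj_irrefl: "\<not> adj v v"
  using simple by (auto simp: adj_def simple_graph_def)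

lemma adj_neq: "adj v w \<Longrightarrow> v \<noteq> w"
  using adj_irrefl by auto

lemma no_chord:
  assumes "is_cycle G c" "adj v w" "v \<in> set c" "w \<in> set c" "{v, w} \<notin> cycle_edges c"
  shows False
  using assms chordless by (auto simp: contains_chorded_cycle_def is_chord_def adj_def)

lemma no_chorded_4_cycle:
  assumes "adj p q" "adj q r" "adj r s" "adj s p" "adj p r"
  shows "q = s"
proof (rule ccontr)
  assume "q \<noteq> s"
  have "distinct [p, q, r, s]"
    using \<open>q \<noteq> s\<close> assms[THEN adj_neq] by simp
  moreover have "is_cycle G [p, q, r, s]"
    using assms assms[THEN adj_V(1)] calculation by (simp add: is_cycle_def cycle_edges_4 adj_def)
  ultimately show False
    using no_chord[of "[p, q, r, s]" p r] assms by (auto simp: cycle_edges_4 doubleton_eq_iff)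
qed

lemma no_chorded_5_cycle:
  assumes "adj p q" "adj q r" "adj r s" "adj s t" "adj t p" "adj p r"
  shows "\<not> distinct [p, q, r, s, t]"
proof
  assume dist: "distinct [p, q, r, s, t]"
  then have "is_cycle G [p, q, r, s, t]"
    using assms assms[THEN adj_V(1)] by (simp add: is_cycle_def cycle_edges_5 adj_def)
  with dist show False
    using no_chord[of "[p, q, r, s, t]" p r] assms by (auto simp: cycle_edges_5 doubleton_eq_iff)
qed

text \<open>Up to rotation and reflection a chord of a hexagon joins vertices at distance two (p, r)
  or three (p, s).\<close>

lemma no_chorded_6_cycle:
  assumes "adj p q" "adj q r" "adj r s" "adj s t" "adj t z" "adj z p" "adj p r \<or> adj p s"
  shows "\<not> distinct [p, q, r, s, t, z]"
proof
  assume dist: "distinct [p, q, r, s, t, z]"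
  then have cyc: "is_cycle G [p, q, r, s, t, z]"
    using assms(1-6) assms(1-6)[THEN adj_V(1)] by (simp add: is_cycle_def cycle_edges_6 adj_def)
  show False
    using assms(7) dist no_chord[OF cyc, of p r] no_chord[OF cyc, of p s]
    by (auto simp: cycle_edges_6 doubleton_eq_iff)
qed

text \<open>Otherwise u v w y is a 4-cycle with chord uw. Hence every neighbourhood induces a
  matching.\<close>

lemma no_path_in_neighbourhood:
  assumes "adj u v" "adj u w" "adj u y" "adj v w" "adj w y"
  shows "v = y"
  using no_chorded_4_cycle[of u v w y] assms adj_commute[of u y] by simp

text \<open>A second way back from w into the neighbourhood of u closes the 5-cycle u v' v w y with
  chord uv. The vertex v' is excluded as y because u, v', w would be a path in the neighbourhood of
  v.\<close>

lemma no_path_from_triangle: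
  assumes "adj u v" "adj u v'" "adj v v'" "adj v w" "\<not> adj u w" "w \<noteq> u" "adj w y" "adj u y"
  shows "y = v"
proof (rule ccontr)
  assume y: "y \<noteq> v"
  have "y \<noteq> v'"
    using no_path_in_neighbourhood[of v u v' w] assms adj_commute[of v' w] adj_commute[of u v] by auto
  with assms y have "distinct [u, v', v, w, y]"
    using assms(1-4,7,8)[THEN adj_neq] by auto
  moreover have "adj v' v" "adj y u"
    using assms adj_commute[of v v'] adj_commute[of u y] by simp_all
  ultimately show False
    using assms no_chorded_5_cycle[of u v' v w y] by blast
qed

text \<open>The same idea with a detour of two vertices: the hexagon u v' v w w' y has chord uv, and
  if y = v' the 5-cycle v' u v w w' has chord vv'.\<close>

lemma no_long_path_from_triangle:
  assumes "adj u v" "adj u v'" "adj v v'" "adj v w" "\<not> adj u w" "w \<noteq> u"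
    "adj w w'" "\<not> adj u w'" "w' \<noteq> u" "adj w' y" "adj u y"
  shows "y = v"
proof (rule ccontr)
  assume y: "y \<noteq> v"
  note neq = assms(1-4,7,10,11)[THEN adj_neq]
  have sym: "adj v' v" "adj v' u" "adj y u"
    using assms adj_commute[of v v'] adj_commute[of u y] adj_commute[of u v'] by simp_all
  show False
  proof (cases "y = v'")
    case True
    with assms y neq have "distinct [v', u, v, w, w']"
      by auto
    then show False
      using assms True sym no_chorded_5_cycle[of v' u v w w'] by blast
  next
    case False
    with assms y neq have "distinct [u, v', v, w, w', y]"
      by auto
    then show False
      using assms sym no_chorded_6_cycle[of u v' v w w' y] by blast
  qed
qed

text \<open>The hexagon u p v q w r has the chord uq. This will bound one class of a complete
  bipartite G by 2.\<close>

lemma no_complete_bipartite_3_3: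
  assumes "distinct [u, v, w]" "distinct [p, q, r]"
    and adj: "\<And>y z. y \<in> {u, v, w} \<Longrightarrow> z \<in> {p, q, r} \<Longrightarrow> adj y z"
  shows False
proof -
  have "adj u p" "adj u q" "adj u r" "adj v p" "adj v q" "adj v r" "adj w p" "adj w q" "adj w r"
    by (simp_all add: adj)
  note * = this this[unfolded adj_commute[of u] adj_commute[of v] adj_commute[of w]]
  have "distinct [u, p, v, q, w, r]"
    using assms(1,2) *[THEN adj_neq] by auto
  then show False
    using no_chorded_6_cycle[of u p v q w r] * by blast
qed

lemma sum_a_eq_card: "finite S \<Longrightarrow> (\<Sum>w\<in>S. a v w) = real (card {w \<in> S. adj v w})"
  by (simp add: sum_of_bool_eq Int_def)

text \<open>Double counting of incidences: w \<mapsto> {v, w} maps the neighbours of v bijectively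
  onto the edges at v.\<close>

lemma handshake: "(\<Sum>v\<in>V. \<Sum>w\<in>V. a v w) = 2 * real (card (edges G))"
proof -
  have finE: "finite (edges G)"
    using simple finite_V by (auto simp: simple_graph_def intro: finite_subset[of _ "Pow V"])
  have e2: "finite e \<and> e \<subseteq> V \<and> card e = 2" if "e \<in> edges G" for e
    using simple that by (auto simp: simple_graph_def intro: card_ge_0_finite)
  have "(\<Sum>v\<in>V. \<Sum>w\<in>V. a v w) = (\<Sum>v\<in>V. \<Sum>e\<in>edges G. of_bool (v \<in> e))"
  proof (rule sum.cong)
    fix v assume "v \<in> V"
    have "bij_betw (\<lambda>w. {v, w}) {w \<in> V. adj v w} {e \<in> edges G. v \<in> e}"
      unfolding bij_betw_def
    proof
      show "inj_on (\<lambda>w. {v, w}) {w \<in> V. adj v w}"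
        by (auto simp: inj_on_def doubleton_eq_iff)
      show "(\<lambda>w. {v, w}) ` {w \<in> V. adj v w} = {e \<in> edges G. v \<in> e}"
      proof (intro equalityI subsetI)
        fix e assume e: "e \<in> {e \<in> edges G. v \<in> e}"
        then obtain w where "e = {v, w}"
          using e2[of e] by (auto simp: card_2_iff)
        with e show "e \<in> (\<lambda>w. {v, w}) ` {w \<in> V. adj v w}"
          using adj_V by (auto simp: adj_def)
      qed (auto simp: adj_def)
    qed
    from bij_betw_same_card[OF this]
    show "(\<Sum>w\<in>V. a v w) = (\<Sum>e\<in>edges G. of_bool (v \<in> e))"
      using finE finite_V by (simp add: sum_a_eq_card sum_of_bool_eq Int_def)
  qed simp
  also have "\<dots> = (\<Sum>e\<in>edges G. \<Sum>v\<in>V. of_bool (v \<in> e))"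
    by (rule sum.swap)
  also have "\<dots> = (\<Sum>e\<in>edges G. 2)"
  proof (rule sum.cong)
    fix e assume "e \<in> edges G"
    then have "V \<inter> {v. v \<in> e} = e" "card e = 2" using e2 by auto
    then show "(\<Sum>v\<in>V. of_bool (v \<in> e)) = (2::real)"
      using finite_V by (simp add: sum_of_bool_eq)
  qed simp
  finally show ?thesis by simp
qed

end

section \<open>The partition of the vertices around a root u\<close>

locale rooted_chordless_graph = chordless_graph +
  fixes u :: 'a
  assumes u: "u \<in> V"
begin

definition N where "N = {v \<in> V. adj u v}"

text \<open>\<open>W\<close> also contains the vertices of the components avoiding \<open>u\<close>.\<close>

definition W where "W = V - insert u N"

text \<open>The vertices covered by the matching that G induces on \<open>N\<close>. Its edges are
  those opposite u in the triangles at u, so \<open>card M\<close> is twice the number t of these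
  triangles.\<close>

definition M where "M = {v \<in> N. \<exists>v'\<in>N. adj v v'}"

text \<open>The vertices at distance two whose link to \<open>N\<close> is restricted by a triangle
  at u.\<close>

definition A where "A = {w \<in> W. \<exists>v\<in>M. adj v w}"

abbreviation dN :: "'a \<Rightarrow> real" where "dN w \<equiv> (\<Sum>v\<in>N. a v w)"

lemma subsets: "N \<subseteq> V" "W \<subseteq> V" "M \<subseteq> N" "A \<subseteq> W"
  by (auto simp: N_def W_def M_def A_def)

lemma finite_subsets: "finite N" "finite W" "finite M" "finite A"
  by (rule finite_subset[OF _ finite_V], use subsets in blast)+

lemma sum_V: "(\<Sum>v\<in>V. f v) = f u + (\<Sum>v\<in>N. f v) + (\<Sum>v\<in>W. f v)" for f :: "'a \<Rightarrow> real"
proof -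
  have "V = insert u (N \<union> W)" "u \<notin> N \<union> W" "N \<inter> W = {}"
    using u adj_irrefl by (auto simp: N_def W_def)
  then show ?thesis
    using finite_subsets by (simp add: sum.union_disjoint)
qed

lemma sum_W: "(\<Sum>v\<in>W. f v) = (\<Sum>v\<in>A. f v) + (\<Sum>v\<in>W - A. f v)" for f :: "'a \<Rightarrow> real"
  using sum.subset_diff[OF subsets(4) finite_subsets(2), of f] by simp

lemma sum_a_unique:
  assumes "finite S" "w \<in> S" "adj v w" "\<And>w'. w' \<in> S \<Longrightarrow> adj v w' \<Longrightarrow> w' = w"
  shows "(\<Sum>w\<in>S. a v w) = 1"
proof -
  have "{w \<in> S. adj v w} = {w}" using assms(2-4) by blast
  then show ?thesis unfolding sum_a_eq_card[OF assms(1)] by simp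
qed

lemma dN_N:
  assumes "v \<in> N"
  shows "dN v = of_bool (v \<in> M)"
proof (cases "v \<in> M")
  case True
  then obtain v' where v': "v \<in> N" "v' \<in> N" "adj v v'" by (auto simp: M_def)
  have "(\<Sum>y\<in>N. a v y) = 1"
  proof (rule sum_a_unique[of _ v'])
    show "y = v'" if "y \<in> N" "adj v y" for y
      using no_path_in_neighbourhood[of u y v v'] that v' adj_commute[of v y] by (simp add: N_def)
  qed (use v' finite_subsets in auto)
  with True show ?thesis by (simp add: adj_commute)
next
  case False
  then have "\<not> adj y v" if "y \<in> N" for y
    using assms that adj_commute[of y v] by (auto simp: M_def)
  with False show ?thesis by simp
qed

lemma sum_M_N: "v \<in> N \<Longrightarrow> (\<Sum>y\<in>M. a y v) = of_bool (v \<in> M)"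
proof -
  assume v: "v \<in> N"
  have "\<not> adj y v" if "y \<in> N - M" for y
    using that v by (auto simp: M_def)
  then have "(\<Sum>y\<in>M. a y v) = dN v"
    using v finite_subsets subsets(3) by (intro sum.mono_neutral_left) auto
  with dN_N[OF v] show ?thesis by simp
qed

text \<open>Two neighbours of w in \<open>N\<close>, one of them matched, are excluded by
  \<open>no_path_from_triangle\<close>; so the only neighbour of w in \<open>N\<close> is
  matched.\<close>

lemma dN_A:
  assumes "w \<in> A"
  shows "dN w = 1" "(\<Sum>v\<in>M. a v w) = 1"
proof -
  obtain v where v: "v \<in> M" "adj v w" "w \<in> W" using assms by (auto simp: A_def)
  then obtain v' where v': "adj u v" "adj u v'" "adj v v'" by (auto simp: M_def N_def)
  have w: "\<not> adj u w" "w \<noteq> u" using v by (auto simp: W_def N_def)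
  have uniq: "y = v" if "y \<in> N" "adj w y" for y
    using no_path_from_triangle[OF v' v(2) w] that by (auto simp: N_def)
  have sym: "a y w = a w y" for y by (simp add: adj_commute)
  have "v \<in> N" "adj w v" using v subsets adj_commute[of v w] by auto
  then show "dN w = 1" "(\<Sum>v\<in>M. a v w) = 1"
    using uniq v(1) finite_subsets subsets(3) sum_a_unique[of N v w] sum_a_unique[of M v w]
    unfolding sym by blast+
qed

lemma sum_M_W:
  assumes "w \<in> W"
  shows "(\<Sum>v\<in>M. a v w) = of_bool (w \<in> A)"
proof (cases "w \<in> A")
  case False
  then have "\<not> adj v w" if "v \<in> M" for v
    using assms that by (auto simp: A_def)
  with False show ?thesis by simp
qed (simp add: dN_A)

text \<open>Adjacent vertices of \<open>A\<close> hang off the same matched vertex v, by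
  \<open>no_long_path_from_triangle\<close>. Two neighbours of w in \<open>A\<close> would thus
  form, with w, a path in the neighbourhood of v.\<close>

lemma A_degree:
  assumes "w \<in> A"
  shows "(\<Sum>y\<in>A. a w y) \<le> 1"
proof -
  obtain v where v: "v \<in> M" "adj v w" "w \<in> W" using assms by (auto simp: A_def)
  then obtain v' where v': "adj u v" "adj u v'" "adj v v'" by (auto simp: M_def N_def)
  have w: "\<not> adj u w" "w \<noteq> u" using v by (auto simp: W_def N_def)
  have adj_v: "adj v y" if "y \<in> A" "adj w y" for y
  proof -
    obtain z where "z \<in> M" "adj z y" using \<open>y \<in> A\<close> by (auto simp: A_def)
    moreover have "\<not> adj u y" "y \<noteq> u" using \<open>y \<in> A\<close> by (auto simp: A_def W_def N_def)
    ultimately have "z = v"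
      using no_long_path_from_triangle[OF v' v(2) w \<open>adj w y\<close>] by (auto simp: M_def N_def adj_commute)
    with \<open>adj z y\<close> show ?thesis by simp
  qed
  have "card {y \<in> A. adj w y} \<le> Suc 0"
  proof (subst card_le_Suc0_iff_eq, use finite_subsets in simp, intro ballI)
    fix y z assume "y \<in> {y \<in> A. adj w y}" "z \<in> {y \<in> A. adj w y}"
    then show "y = z"
      using adj_v no_path_in_neighbourhood[of v y w z] v(2) adj_commute[of w y] by simp
  qed
  then show ?thesis using sum_a_eq_card[OF finite_subsets(4), of w] by linarith
qed

text \<open>The number of edges inside \<open>W\<close>; the double sum meets each of them
  twice.\<close>

definition e_W :: real where "e_W = (\<Sum>v\<in>W. \<Sum>w\<in>W. a v w) / 2"

lemma card_edges: "real (card (edges G)) = card N + card M / 2 + (\<Sum>w\<in>W. dN w) + e_W"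
proof -
  have "adj u w" if "w \<in> N" for w using that by (simp add: N_def)
  moreover have "\<not> adj u w" if "w \<in> W" for w using that by (auto simp: W_def N_def)
  ultimately have 0: "a u u = 0" "(\<Sum>w\<in>W. a u w) = 0" "(\<Sum>w\<in>N. a u w) = card N"
    using adj_irrefl by simp_all
  have 1: "(\<Sum>v\<in>N. a v u) = card N" "(\<Sum>w\<in>W. a w u) = 0" using 0 by (simp_all add: adj_commute)
  have 2: "(\<Sum>v\<in>N. \<Sum>w\<in>N. a v w) = card M"
  proof -
    have "(\<Sum>v\<in>N. \<Sum>w\<in>N. a v w) = (\<Sum>w\<in>N. dN w)" by (rule sum.swap)
    also have "\<dots> = (\<Sum>w\<in>N. of_bool (w \<in> M))" by (simp add: dN_N)
    also have "\<dots> = card M"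
      using finite_subsets subsets by (simp add: sum_of_bool_eq Int_absorb1)
    finally show ?thesis .
  qed
  have 3: "(\<Sum>v\<in>W. \<Sum>w\<in>N. a v w) = (\<Sum>w\<in>W. dN w)" by (simp add: adj_commute)
  have 4: "(\<Sum>v\<in>N. \<Sum>w\<in>W. a v w) = (\<Sum>w\<in>W. dN w)" by (rule sum.swap)
  \<comment> \<open>The degree sum is cut into nine blocks by the partition into u, \<open>N\<close>
    and \<open>W\<close>.\<close>
  have "2 * real (card (edges G)) =
      a u u + (\<Sum>w\<in>N. a u w) + (\<Sum>w\<in>W. a u w)
      + ((\<Sum>v\<in>N. a v u) + (\<Sum>v\<in>N. \<Sum>w\<in>N. a v w) + (\<Sum>v\<in>N. \<Sum>w\<in>W. a v w))
      + ((\<Sum>w\<in>W. a w u) + (\<Sum>v\<in>W. \<Sum>w\<in>N. a v w) + (\<Sum>v\<in>W. \<Sum>w\<in>W. a v w))"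
    unfolding handshake[symmetric] sum_V sum.distrib by simp
  then show ?thesis
    unfolding 0 1 2 3 4 e_W_def by simp
qed

text \<open>The slack \<open>s4\<close> below.  For small \<open>r\<close>, bounding \<open>D\<close> by \<open>2 * e_W\<close> alone is too weak; one also needs
  that \<open>A\<close> induces a matching, which gives \<open>2 * D \<le> 2 * e_W + card A\<close>.  For \<open>m \<le> 4\<close> and \<open>A \<noteq> {}\<close> there is no room
  for an edge inside \<open>W\<close>.\<close>

lemma excess_estimate:
  fixes r D :: real
  assumes r: "r > 7/3 \<or> (r > 2 \<and> card (edges G) \<le> 4)"
  defines "D \<equiv> (\<Sum>v\<in>A. \<Sum>w\<in>W. a v w)"
  shows "card A + D \<le> (r - 1) * (card A + e_W)"
    and "card A + D = (r - 1) * (card A + e_W) \<Longrightarrow> A = {} \<and> e_W = 0"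
proof -
  define D' where "D' = (\<Sum>v\<in>A. \<Sum>w\<in>A. a v w)"
  have D': "D' \<le> card A"
    using sum_mono[of A "\<lambda>v. \<Sum>w\<in>A. a v w" "\<lambda>_. 1"] A_degree by (simp add: D'_def)
  have rest: "(\<Sum>v\<in>W - A. \<Sum>w\<in>W - A. a v w) \<ge> 0" "(\<Sum>v\<in>W - A. \<Sum>w\<in>W. a v w) \<ge> 0"
    by (simp_all add: sum_nonneg)
  have sym: "(\<Sum>v\<in>A. \<Sum>w\<in>W - A. a v w) = (\<Sum>v\<in>W - A. \<Sum>w\<in>A. a v w)"
    by (subst sum.swap) (simp add: adj_commute)
  have "2 * e_W = D + (\<Sum>v\<in>W - A. \<Sum>w\<in>W. a v w)"
    unfolding e_W_def D_def using sum_W[of "\<lambda>v. \<Sum>w\<in>W. a v w"] by simp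
  moreover have "(\<Sum>v\<in>W - A. \<Sum>w\<in>W. a v w)
      = (\<Sum>v\<in>W - A. \<Sum>w\<in>A. a v w) + (\<Sum>v\<in>W - A. \<Sum>w\<in>W - A. a v w)"
    by (simp only: sum_W sum.distrib)
  moreover have "D = D' + (\<Sum>v\<in>A. \<Sum>w\<in>W - A. a v w)"
    unfolding D_def D'_def by (simp only: sum_W sum.distrib)
  \<comment> \<open>Let E count the edges between \<open>A\<close> and \<open>W - A\<close>. Then D
    = D' + E, while 2 \<open>e_W\<close> is at least D' + 2E. The second bound also uses that D' is
    at most \<open>card A\<close>.\<close>
  ultimately have D: "D \<le> 2 * e_W" "2 * D \<le> 2 * e_W + card A"
    using rest sym D' by linarith+
  have nonneg: "D \<ge> 0" by (simp add: D_def sum_nonneg)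
  have e_W: "e_W \<ge> 0" by (simp add: e_W_def sum_nonneg)
  have A0: "D = 0" if "A = {}" using that by (simp add: D_def)
  have "card A + D \<le> (r - 1) * (card A + e_W) \<and>
    (card A + D = (r - 1) * (card A + e_W) \<longrightarrow> card A + e_W = 0)"
  proof (cases "A = {}")
    case True
    then show ?thesis using A0 r e_W by auto
  next
    case False
    then have cA: "card A \<ge> 1" using finite_subsets by (simp add: Suc_le_eq card_gt_0_iff)
    show ?thesis
    proof (cases "r > 7/3")
      case True
      \<comment> \<open>Adding one third of each of the two bounds on D gives exactly the factor
        4/3, the origin of the threshold 7/3 for r.\<close>
      have "card A + D \<le> 4/3 * (card A + e_W)" using D by (simp add: field_simps)
      also have "\<dots> < (r - 1) * (card A + e_W)"
        using True cA e_W by (intro mult_strict_right_mono) auto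
      finally show ?thesis by simp
    next
      case False
      then have r: "r > 2" "card (edges G) \<le> 4" using r by auto
      \<comment> \<open>A vertex in \<open>A\<close> presupposes a triangle at u. Its three edges
        and the edge from \<open>A\<close> to \<open>N\<close> use up all four edges, leaving none
        inside \<open>W\<close>.\<close>
      obtain v where "v \<in> M" using \<open>A \<noteq> {}\<close> by (auto simp: A_def)
      then obtain v' where v': "v \<in> M" "v' \<in> M" "v \<noteq> v'"
        using adj_irrefl adj_commute by (auto simp: M_def)
      then have "card {v, v'} \<le> card M" "card M \<le> card N"
        by (intro card_mono finite_subsets subsets; simp)+
      then have "card M \<ge> 2" "card N \<ge> 2" using v' by simp_all
      moreover have "(\<Sum>w\<in>W. dN w) \<ge> card A"
        unfolding sum_W[of dN] by (simp add: dN_A sum_nonneg)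
      ultimately have "card A + e_W \<le> 1" using r(2) card_edges by linarith
      with cA D nonneg e_W have "e_W = 0" "D = 0" by linarith+
      with cA r show ?thesis by simp
    qed
  qed
  then show "card A + D \<le> (r - 1) * (card A + e_W)"
    "card A + D = (r - 1) * (card A + e_W) \<Longrightarrow> A = {} \<and> e_W = 0"
    using e_W finite_subsets by (auto simp: add_nonneg_eq_0_iff)
qed

end

section \<open>The spectral inequality and its equality case\<close>

locale subinvariant_graph = rooted_chordless_graph +
  fixes x :: "'a \<Rightarrow> real" and r :: real
  assumes x_nonneg: "v \<in> V \<Longrightarrow> 0 \<le> x v" and x_le_1: "v \<in> V \<Longrightarrow> x v \<le> 1" and x_u: "x u = 1"
    and subinvariant: "v \<in> V \<Longrightarrow> r * x v \<le> (\<Sum>w\<in>V. a v w * x w)"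
    and r: "r > 7/3 \<or> (r > 2 \<and> card (edges G) \<le> 4)"
begin

lemma r_gt_2: "r > 2" using r by auto

text \<open>The losses in the estimates that lead to \<open>spectral_bound\<close>.\<close>

definition s1 where "s1 = r * (\<Sum>v\<in>N. x v) - r\<^sup>2"

definition s2 where "s2 = (\<Sum>v\<in>N. (\<Sum>w\<in>V. a v w * x w) - r * x v)"

definition s3 where "s3 = (\<Sum>w\<in>W - A. dN w * (1 - x w))"

definition s4 where "s4 = (r - 1) * (card A + e_W) - (card A + (\<Sum>v\<in>A. \<Sum>w\<in>W. a v w))"

lemma slack_nonneg: "s1 \<ge> 0" "s2 \<ge> 0" "s3 \<ge> 0" "s4 \<ge> 0"
proof -
  \<comment> \<open>Subinvariance at the root: since x u = 1, the weights on \<open>N\<close> sum to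
    at least r.\<close>
  have "r * x u \<le> (\<Sum>w\<in>V. a u w * x w)" using subinvariant u by blast
  also have "\<dots> = (\<Sum>w\<in>N. x w)"
    by (rule sum.mono_neutral_cong_right) (use finite_V in \<open>auto simp: N_def\<close>)
  finally have "r * r \<le> r * (\<Sum>w\<in>N. x w)"
    using r_gt_2 x_u by simp
  then show "s1 \<ge> 0" by (simp add: s1_def power2_eq_square)
  show "s2 \<ge> 0"
    unfolding s2_def using subinvariant subsets by (intro sum_nonneg) auto
  show "s3 \<ge> 0"
    unfolding s3_def using x_le_1 subsets by (intro sum_nonneg mult_nonneg_nonneg) auto
  show "s4 \<ge> 0"
    using excess_estimate(1)[OF r] by (simp add: s4_def)
qed

text \<open>Subinvariance is summed over \<open>M\<close>. The root is met once per matched vertex,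
  each matched vertex once from its partner, and each vertex of \<open>A\<close> once; moving the
  partner terms to the left turns r into r - 1.\<close>

lemma sum_M_x: "(r - 1) * (\<Sum>v\<in>M. x v) \<le> card M + (\<Sum>w\<in>A. x w)"
proof -
  have "r * (\<Sum>v\<in>M. x v) \<le> (\<Sum>v\<in>M. \<Sum>w\<in>V. a v w * x w)"
    unfolding sum_distrib_left using subinvariant subsets by (intro sum_mono) auto
  also have "\<dots> = (\<Sum>w\<in>V. (\<Sum>v\<in>M. a v w) * x w)"
    by (subst sum.swap) (simp add: sum_distrib_right)
  also have "\<dots> = (\<Sum>v\<in>M. a v u) + (\<Sum>w\<in>N. (\<Sum>v\<in>M. a v w) * x w) + (\<Sum>w\<in>W. (\<Sum>v\<in>M. a v w) * x w)"
    unfolding sum_V x_u by simp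
  also have "(\<Sum>v\<in>M. a v u) = card M"
  proof -
    have "adj v u" if "v \<in> M" for v using that adj_commute[of v u] by (simp add: M_def N_def)
    then show ?thesis by simp
  qed
  also have "(\<Sum>w\<in>N. (\<Sum>v\<in>M. a v w) * x w) = (\<Sum>w\<in>N. of_bool (w \<in> M) * x w)"
    by (intro sum.cong refl) (simp only: sum_M_N)
  also have "\<dots> = (\<Sum>w\<in>M. x w)"
    by (rule sum.mono_neutral_cong_right) (use finite_subsets subsets in auto)
  also have "(\<Sum>w\<in>W. (\<Sum>v\<in>M. a v w) * x w) = (\<Sum>w\<in>W. of_bool (w \<in> A) * x w)"
    by (intro sum.cong refl) (simp only: sum_M_W)
  also have "\<dots> = (\<Sum>w\<in>A. x w)"
    by (rule sum.mono_neutral_cong_right) (use finite_subsets subsets in auto)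
  finally show ?thesis by (simp add: algebra_simps)
qed

text \<open>A vertex of \<open>A\<close> has one neighbour in \<open>N\<close> and all others in
  \<open>W\<close>; every weight is bounded by 1.\<close>

lemma sum_A_x: "r * (\<Sum>w\<in>A. x w) \<le> card A + (\<Sum>v\<in>A. \<Sum>w\<in>W. a v w)"
proof -
  have "r * x v \<le> 1 + (\<Sum>w\<in>W. a v w)" if v: "v \<in> A" for v
  proof -
    have "v \<in> W" using v subsets by auto
    then have "a v u = 0" using adj_commute[of v u] by (simp add: W_def N_def)
    have "r * x v \<le> (\<Sum>w\<in>V. a v w * x w)" using subinvariant v subsets by blast
    also have "\<dots> \<le> (\<Sum>w\<in>V. a v w)" using x_le_1 by (intro sum_mono) simp
    also have "\<dots> = (\<Sum>w\<in>N. a v w) + (\<Sum>w\<in>W. a v w)"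
      unfolding sum_V \<open>a v u = 0\<close> by simp
    also have "(\<Sum>w\<in>N. a v w) = dN v" by (simp add: adj_commute)
    finally show ?thesis using dN_A(1)[OF v] by simp
  qed
  then have "(\<Sum>v\<in>A. r * x v) \<le> (\<Sum>v\<in>A. 1 + (\<Sum>w\<in>W. a v w))"
    by (rule sum_mono)
  then show ?thesis by (simp add: sum.distrib sum_distrib_left)
qed

lemma spectral_bound:
  "(r - 1) * (r\<^sup>2 - card (edges G)) + (r - 1) * (s1 + s2 + s3) + s4 \<le> card M / 2 * (3 - r)"
proof -
  define X where "X = (\<Sum>v\<in>M. x v)"
  define S where "S = (\<Sum>w\<in>A. x w)"
  define T where "T = (\<Sum>w\<in>W - A. dN w)"
  define D where "D = (\<Sum>v\<in>A. \<Sum>w\<in>W. a v w)"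
  \<comment> \<open>Walks of length two from u: applying the adjacency matrix at u and then on
    \<open>N\<close> loses \<open>s1\<close> and \<open>s2\<close>; replacing x by 1 on
    \<open>W - A\<close> loses \<open>s3\<close>.\<close>
  have "r\<^sup>2 + (s1 + s2) = (\<Sum>v\<in>N. \<Sum>w\<in>V. a v w * x w)"
    by (simp add: s1_def s2_def sum_subtractf sum_distrib_left)
  also have "\<dots> = (\<Sum>w\<in>V. dN w * x w)"
    by (subst sum.swap) (simp add: sum_distrib_right)
  also have "\<dots> = dN u + (\<Sum>w\<in>N. dN w * x w) + ((\<Sum>w\<in>A. dN w * x w) + (\<Sum>w\<in>W - A. dN w * x w))"
    unfolding sum_V[of "\<lambda>w. dN w * x w"] sum_W[of "\<lambda>w. dN w * x w"] x_u by simp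
  also have "dN u = card N"
  proof -
    have "adj v u" if "v \<in> N" for v using that adj_commute[of v u] by (simp add: N_def)
    then show ?thesis by simp
  qed
  also have "(\<Sum>w\<in>N. dN w * x w) = (\<Sum>w\<in>N. of_bool (w \<in> M) * x w)"
    by (intro sum.cong refl) (simp only: dN_N)
  also have "\<dots> = X"
    unfolding X_def by (rule sum.mono_neutral_cong_right) (use finite_subsets subsets in auto)
  also have "(\<Sum>w\<in>A. dN w * x w) = S"
    unfolding S_def by (intro sum.cong refl) (simp only: dN_A mult_1)
  also have "(\<Sum>w\<in>W - A. dN w * x w) = T - s3"
    by (simp add: T_def s3_def right_diff_distrib sum_subtractf)
  finally have 1: "r\<^sup>2 + (s1 + s2 + s3) = card N + X + S + T" by simp
  have "(\<Sum>w\<in>W. dN w) = card A + T"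
    unfolding sum_W[of dN] T_def by (simp add: dN_A)
  then have m: "real (card (edges G)) = card N + card M / 2 + card A + T + e_W"
    using card_edges by simp
  have X: "(r - 1) * X \<le> card M + S" using sum_M_x by (simp add: X_def S_def)
  have S: "r * S \<le> card A + D" using sum_A_x by (simp add: S_def D_def)
  have "(r - 1) * (r\<^sup>2 - card (edges G)) + (r - 1) * (s1 + s2 + s3)
      = (r - 1) * ((r\<^sup>2 + (s1 + s2 + s3)) - card (edges G))"
    by (simp add: algebra_simps)
  also have "\<dots> = (r - 1) * (X + S - card M / 2 - card A - e_W)"
    unfolding 1 m by simp
  \<comment> \<open>Split so that the term S from the bound on (r - 1) X cancels and only r S
    remains, to which \<open>sum_A_x\<close> applies.\<close>
  also have "\<dots> = (r - 1) * X - S + r * S - (r - 1) * (card M / 2) - (r - 1) * (card A + e_W)"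
    by (simp add: algebra_simps)
  also have "\<dots> \<le> card M - (r - 1) * (card M / 2) - s4"
    using X S by (simp add: s4_def D_def)
  also have "card M - (r - 1) * (card M / 2) - s4 = card M / 2 * (3 - r) - s4"
    by (simp add: field_simps)
  finally show ?thesis by linarith
qed

text \<open>Together with \<open>spectral_bound\<close> the assumption makes every loss vanish. From
  \<open>s4\<close> there is no \<open>A\<close> and no edge inside \<open>W\<close>;
  \<open>s1\<close> gives weight sum r on \<open>N\<close>; \<open>s2\<close> makes weights on
  \<open>N\<close> positive; \<open>s3\<close> gives weight 1 to each vertex of \<open>W\<close>
  with a neighbour in \<open>N\<close>.\<close>

lemma equality_case:
  assumes isolate_free: "isolate_free G"
    and eq: "card M / 2 * (3 - r) \<le> (r - 1) * (r\<^sup>2 - card (edges G))"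
  shows "w \<in> W \<Longrightarrow> v \<in> V \<Longrightarrow> adj w v \<longleftrightarrow> v \<in> N" and "M \<noteq> {} \<Longrightarrow> W = {}"
proof -
  have "(r - 1) * (s1 + s2 + s3) \<ge> 0" using slack_nonneg r_gt_2 by simp
  then have "(r - 1) * (s1 + s2 + s3) = 0" and s4: "s4 = 0"
    using spectral_bound eq slack_nonneg by linarith+
  then have "s1 + s2 + s3 = 0" using r_gt_2 by simp
  then have s: "s1 = 0" "s2 = 0" "s3 = 0" using slack_nonneg by linarith+
  from s4 have A: "A = {}" and e_W: "e_W = 0"
    using excess_estimate(2)[OF r] by (auto simp: s4_def)
  have N_sum: "(\<Sum>v\<in>N. x v) = r"
    using s(1) r_gt_2 by (simp add: s1_def power2_eq_square)
  have pos: "x v > 0" if v: "v \<in> N" for v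
  proof -
    have "(\<Sum>w\<in>V. a v w * x w) - r * x v = 0"
      using s(2) v subinvariant subsets finite_subsets
      unfolding s2_def by (subst (asm) sum_nonneg_eq_0_iff) auto
    moreover have "a v u * x u \<le> (\<Sum>w\<in>V. a v w * x w)"
      using u finite_V x_nonneg by (intro member_le_sum) auto
    moreover have "a v u = 1" using v adj_commute[of v u] by (simp add: N_def)
    ultimately have "r * x v \<ge> 1" using x_u by simp
    moreover have "x v \<ge> 0" using x_nonneg v subsets by blast
    ultimately show ?thesis by (cases "x v = 0") auto
  qed
  have W_adj: "\<not> adj w w'" if "w \<in> W" "w' \<in> W" for w w'
  proof -
    have "(\<Sum>v\<in>W. a w v) = 0"
      using e_W that finite_subsets unfolding e_W_def
      by (auto simp: sum_nonneg_eq_0_iff sum_nonneg simp del: sum_of_bool_eq)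
    then show ?thesis using that finite_subsets
      by (auto simp: sum_nonneg_eq_0_iff simp del: sum_of_bool_eq)
  qed
  have W_N: "adj w v \<longleftrightarrow> v \<in> N" if w: "w \<in> W" and "v \<in> V" for w v
  proof -
    have wV: "w \<in> V" "\<not> adj w u"
      using w subsets adj_commute[of w u] by (auto simp: W_def N_def)
    have sub: "y \<in> N" if "adj w y" for y
      using that wV W_adj[OF w, of y] adj_V(2)[of w y] by (auto simp: W_def)
    \<comment> \<open>As w is not isolated and has no neighbour in \<open>W\<close>, it has one in
      \<open>N\<close>, which forces x w = 1.\<close>
    obtain e where "e \<in> edges G" "w \<in> e" "card e = 2"
      using isolate_free wV simple by (auto simp: isolate_free_def simple_graph_def)
    then obtain y where y: "adj w y"
      by (auto simp: card_2_iff adj_def insert_commute)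
    have "dN w * (1 - x w) = 0"
      using s(3) w x_le_1 subsets finite_subsets unfolding s3_def A
      by (subst (asm) sum_nonneg_eq_0_iff) (auto simp del: sum_of_bool_eq intro!: mult_nonneg_nonneg sum_nonneg)
    moreover have "a y w \<le> dN w"
      using sub[OF y] finite_subsets by (intro member_le_sum) auto
    ultimately have "x w = 1" using y adj_commute[of y w] by auto
    \<comment> \<open>The neighbours of w carry total weight at least r, which is all of the weight
      of \<open>N\<close>; as weights there are positive, no vertex of \<open>N\<close> can be
      missing.\<close>
    then have "r \<le> (\<Sum>v\<in>V. a w v * x v)" using subinvariant[OF wV(1)] by simp
    also have "\<dots> = (\<Sum>v\<in>N. a w v * x v)"
      by (rule sum.mono_neutral_right) (use finite_V subsets sub in auto)
    finally have "(\<Sum>v\<in>N. (1 - a w v) * x v) \<le> 0"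
      using N_sum by (simp add: left_diff_distrib sum_subtractf)
    moreover have nn: "0 \<le> (1 - a w v) * x v" if "v \<in> N" for v
      using that x_nonneg subsets by (intro mult_nonneg_nonneg) auto
    ultimately have "(\<Sum>v\<in>N. (1 - a w v) * x v) = 0"
      by (intro antisym sum_nonneg) auto
    then have "(1 - a w v) * x v = 0" if "v \<in> N" for v
      using that nn finite_subsets by (subst (asm) sum_nonneg_eq_0_iff) auto
    then have "adj w v" if "v \<in> N" for v
      using that pos[OF that] by force
    with sub show ?thesis by blast
  qed
  show "w \<in> W \<Longrightarrow> v \<in> V \<Longrightarrow> adj w v \<longleftrightarrow> v \<in> N" by (rule W_N)
  show "W = {}" if M: "M \<noteq> {}"
  proof (rule ccontr)
    assume "W \<noteq> {}"
    then obtain w v where wv: "w \<in> W" "v \<in> M" using M by auto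
    then have "adj v w" using W_N[of w v] subsets adj_commute[of v w] by auto
    with wv A show False by (auto simp: A_def)
  qed
qed

end

section \<open>Isomorphisms with the extremal graphs\<close>

text \<open>Isomorphisms with the extremal graphs are built as maps out of the concrete graph, where
  a case distinction on the constructors defines them.\<close>

lemma graph_iso_sym:
  assumes "G \<simeq> H"
  shows "H \<simeq> G"
proof -
  obtain f where f: "bij_betw f (verts G) (verts H)"
    "\<And>v w. v \<in> verts G \<Longrightarrow> w \<in> verts G \<Longrightarrow> {v, w} \<in> edges G \<longleftrightarrow> {f v, f w} \<in> edges H"
    using assms by (auto simp: graph_iso_def)
  let ?g = "inv_into (verts G) f"
  have g: "bij_betw ?g (verts H) (verts G)" by (rule bij_betw_inv_into[OF f(1)])
  have "{v, w} \<in> edges H \<longleftrightarrow> {?g v, ?g w} \<in> edges G" if "v \<in> verts H" "w \<in> verts H" for v w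
    using f(2)[of "?g v" "?g w"] that g f(1) by (simp add: bij_betw_inv_into_right bij_betw_apply)
  with g show ?thesis by (auto simp: graph_iso_def)
qed

lemma graph_iso_trans:
  assumes "G \<simeq> H" "H \<simeq> K"
  shows "G \<simeq> K"
proof -
  obtain f g where f: "bij_betw f (verts G) (verts H)"
      "\<And>v w. v \<in> verts G \<Longrightarrow> w \<in> verts G \<Longrightarrow> {v, w} \<in> edges G \<longleftrightarrow> {f v, f w} \<in> edges H"
    and g: "bij_betw g (verts H) (verts K)"
      "\<And>v w. v \<in> verts H \<Longrightarrow> w \<in> verts H \<Longrightarrow> {v, w} \<in> edges H \<longleftrightarrow> {g v, g w} \<in> edges K"
    using assms by (auto simp: graph_iso_def)
  have "\<forall>v\<in>verts G. \<forall>w\<in>verts G. {v, w} \<in> edges G \<longleftrightarrow> {(g \<circ> f) v, (g \<circ> f) w} \<in> edges K"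
    using f g(2) by (simp add: bij_betw_apply)
  then show ?thesis
    using bij_betw_trans[OF f(1) g(1)] unfolding graph_iso_def by blast
qed

lemma doubleton_eq_image:
  assumes "inj f"
  shows "{f a, f b} = f ` e \<longleftrightarrow> e = {a, b}"
  using inj_image_eq_iff[OF assms, of "{a, b}" e] by (metis image_empty image_insert)

lemma disjoint_union_edges:
  "{Inl a, Inl b} \<in> edges (disjoint_union G H) \<longleftrightarrow> {a, b} \<in> edges G"
  "{Inr c, Inr d} \<in> edges (disjoint_union G H) \<longleftrightarrow> {c, d} \<in> edges H"
  "{Inl a, Inr d} \<notin> edges (disjoint_union G H)"
  "{Inr d, Inl a} \<notin> edges (disjoint_union G H)"
  by (auto simp: disjoint_union_def doubleton_eq_image)

lemma graph_join_edges:
  "{Inl a, Inl b} \<in> edges (graph_join G H) \<longleftrightarrow> {a, b} \<in> edges G"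
  "{Inr c, Inr d} \<in> edges (graph_join G H) \<longleftrightarrow> {c, d} \<in> edges H"
  "{Inl a, Inr d} \<in> edges (graph_join G H) \<longleftrightarrow> a \<in> verts G \<and> d \<in> verts H"
  "{Inr d, Inl a} \<in> edges (graph_join G H) \<longleftrightarrow> a \<in> verts G \<and> d \<in> verts H"
  by (simp_all add: graph_join_def disjoint_union_edges doubleton_eq_iff)

lemma copies_edges: "{(i, a), (j, b)} \<in> edges (copies k G) \<longleftrightarrow> i = j \<and> i < k \<and> {a, b} \<in> edges G"
proof
  assume "{(i, a), (j, b)} \<in> edges (copies k G)"
  then obtain l e where e: "{(i, a), (j, b)} = Pair l ` e" "l < k" "e \<in> edges G"
    by (auto simp: copies_def)
  then have l: "i = l" "j = l" by auto
  have "e = {a, b}"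
    using e(1) doubleton_eq_image[of "Pair l" a b e] unfolding l by (simp add: inj_on_def)
  with e(2,3) l show "i = j \<and> i < k \<and> {a, b} \<in> edges G" by simp
next
  assume *: "i = j \<and> i < k \<and> {a, b} \<in> edges G"
  then have "Pair i ` {a, b} \<in> edges (copies k G)"
    unfolding copies_def sgraph.simps mem_Collect_eq by blast
  with * show "{(i, a), (j, b)} \<in> edges (copies k G)" by simp
qed

lemma complete_graph_edges: "{a, b} \<in> edges (complete_graph n) \<longleftrightarrow> a < n \<and> b < n \<and> a \<noteq> b"
  by (auto simp: complete_graph_def card_insert_if)

lemma complete_bipartite_edges:
  "{Inl i, Inl i'} \<notin> edges (complete_bipartite p q)"
  "{Inr j, Inr j'} \<notin> edges (complete_bipartite p q)"
  "{Inl i, Inr j} \<in> edges (complete_bipartite p q) \<longleftrightarrow> i < p \<and> j < q"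
  "{Inr j, Inl i} \<in> edges (complete_bipartite p q) \<longleftrightarrow> i < p \<and> j < q"
  by (auto simp: complete_bipartite_def doubleton_eq_iff)

lemma verts_simps:
  "verts (disjoint_union G H) = verts G <+> verts H"
  "verts (graph_join G H) = verts G <+> verts H"
  "verts (copies k G) = {..<k} \<times> verts G"
  "verts (complete_graph n) = {..<n}"
  "verts (complete_bipartite p q) = {..<p} <+> {..<q}"
  by (simp_all add: disjoint_union_def graph_join_def copies_def complete_graph_def complete_bipartite_def)

lemmas edges_simps = disjoint_union_edges graph_join_edges copies_edges complete_graph_edges
  complete_bipartite_edges

text \<open>The simplifier collapses \<open>{v, v}\<close> to \<open>{v}\<close> before the preceding rules apply.\<close>

lemmas singleton_edges_simps =
  graph_join_edges(1)[of a a for a, simplified] graph_join_edges(2)[of a a for a, simplified]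
  disjoint_union_edges(1)[of a a for a, simplified] disjoint_union_edges(2)[of a a for a, simplified]
  copies_edges[of i a i a for i a, simplified] complete_graph_edges[of a a for a, simplified]

text \<open>t triangles and k pendant edges with a common centre, hence 3t + k edges.\<close>

abbreviation (input) fan :: "nat \<Rightarrow> nat \<Rightarrow> (nat + (nat \<times> nat + nat \<times> nat)) sgraph" where
  "fan t k \<equiv> graph_join (complete_graph 1)
     (disjoint_union (copies t (complete_graph 2)) (copies k (complete_graph 1)))"

text \<open>Bridges \<open>fan t 0\<close> and the form without an empty union, which the theorem
  uses for m = 6 and for three triangles at m = 9.\<close>

lemma graph_join_no_copies:
  "graph_join G (disjoint_union H (copies 0 K)) \<simeq> graph_join G H"
  unfolding graph_iso_def
\<comment> \<open>\<open>undefined\<close> is never evaluated on a vertex, since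
  \<open>copies 0 K\<close> has none.\<close>
proof (intro exI[of _ "map_sum id (case_sum id undefined)"] conjI ballI)
  let ?f = "map_sum id (case_sum id undefined)"
  show "bij_betw ?f (verts (graph_join G (disjoint_union H (copies 0 K)))) (verts (graph_join G H))"
    unfolding bij_betw_def
    by (auto simp: verts_simps inj_on_def Plus_def image_Un image_image)
  fix v w
  assume "v \<in> verts (graph_join G (disjoint_union H (copies 0 K)))"
    "w \<in> verts (graph_join G (disjoint_union H (copies 0 K)))"
  then show "{v, w} \<in> edges (graph_join G (disjoint_union H (copies 0 K))) \<longleftrightarrow>
      {?f v, ?f w} \<in> edges (graph_join G H)"
    by (auto simp: verts_simps edges_simps)
qed

text \<open>Needed because the theorem writes a single K_2 without an index; \<open>snd\<close>
  drops the index 0.\<close>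

lemma graph_join_one_copy:
  "graph_join G (disjoint_union (copies 1 H) K) \<simeq> graph_join G (disjoint_union H K)"
  unfolding graph_iso_def
proof (intro exI[of _ "map_sum id (map_sum snd id)"] conjI ballI)
  let ?f = "map_sum id (map_sum snd id)"
  have *: "?f ` (S <+> (T <+> U)) = S <+> (snd ` T <+> U)" for S T U
    by (simp add: Plus_def image_Un image_image)
  show "bij_betw ?f (verts (graph_join G (disjoint_union (copies 1 H) K)))
      (verts (graph_join G (disjoint_union H K)))"
    unfolding bij_betw_def verts_simps * by (auto simp: inj_on_def)
  fix v w
  assume "v \<in> verts (graph_join G (disjoint_union (copies 1 H) K))"
    "w \<in> verts (graph_join G (disjoint_union (copies 1 H) K))"
  then show "{v, w} \<in> edges (graph_join G (disjoint_union (copies 1 H) K)) \<longleftrightarrow>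
      {?f v, ?f w} \<in> edges (graph_join G (disjoint_union H K))"
    by (auto simp: verts_simps edges_simps)
qed

lemma complete_bipartite_iso:
  assumes V: "verts G = X \<union> Y" "X \<inter> Y = {}" "finite X" "finite Y"
    and E: "\<And>v w. v \<in> verts G \<Longrightarrow> w \<in> verts G \<Longrightarrow>
      {v, w} \<in> edges G \<longleftrightarrow> (v \<in> X \<and> w \<in> Y) \<or> (v \<in> Y \<and> w \<in> X)"
  shows "G \<simeq> complete_bipartite (card X) (card Y)"
proof (rule graph_iso_sym)
  obtain g h where g: "bij_betw g {..<card X} X" and h: "bij_betw h {..<card Y} Y"
    using ex_bij_betw_nat_finite[OF V(3)] ex_bij_betw_nat_finite[OF V(4)]
    by (auto simp: atLeast0LessThan)
  let ?f = "case_sum g h"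
  have im': "g i \<in> X" "g i \<notin> Y" "g i \<in> verts G" if "i < card X" for i
    using that bij_betwE[OF g] V by auto
  have im'': "h i \<in> Y" "h i \<notin> X" "h i \<in> verts G" if "i < card Y" for i
    using that bij_betwE[OF h] V by auto
  have "inj_on ?f (verts (complete_bipartite (card X) (card Y)))"
    using g h im' im'' by (auto simp: inj_on_def bij_betw_def verts_simps) metis+
  moreover have "?f ` verts (complete_bipartite (card X) (card Y)) = verts G"
    using bij_betw_imp_surj_on[OF g] bij_betw_imp_surj_on[OF h]
    by (simp add: verts_simps Plus_def image_Un image_image V)
  moreover have "{v, w} \<in> edges (complete_bipartite (card X) (card Y)) \<longleftrightarrow> {?f v, ?f w} \<in> edges G"
    if "v \<in> verts (complete_bipartite (card X) (card Y))"
      "w \<in> verts (complete_bipartite (card X) (card Y))" for v w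
    using that im' im'' by (auto simp: verts_simps edges_simps E)
  ultimately show "complete_bipartite (card X) (card Y) \<simeq> G"
    unfolding graph_iso_def bij_betw_def by blast
qed

section \<open>Recognising the graph in the equality case\<close>

context rooted_chordless_graph begin

lemma N_degree:
  assumes "p \<in> N" "q \<in> N" "z \<in> N" "adj p q" "adj p z"
  shows "z = q"
  using no_path_in_neighbourhood[of u q p z] assms adj_commute[of p q] by (simp add: N_def)

text \<open>The edges inside \<open>M\<close> are pairwise disjoint by \<open>N_degree\<close> and
  cover \<open>M\<close>. Enumerating them and naming the ends of the i-th edge p i and q i prepares
  the map in \<open>fan_iso\<close>.\<close>

lemma M_matching:
  obtains t p q where "card M = 2 * t" "M = p ` {..<t} \<union> q ` {..<t}"
    "inj_on p {..<t}" "inj_on q {..<t}" "p ` {..<t} \<inter> q ` {..<t} = {}"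
    "\<And>i. i < t \<Longrightarrow> adj (p i) (q i)"
proof -
  define P where "P = {e \<in> edges G. e \<subseteq> M}"
  have finP: "finite P"
    using finite_subsets by (auto simp: P_def intro: finite_subset[of _ "Pow M"])
  have cardP: "card e = 2" if "e \<in> P" for e
    using that simple by (auto simp: P_def simple_graph_def)
  have U: "\<Union>P = M"
  proof (intro equalityI subsetI)
    fix v assume "v \<in> M"
    then obtain v' where "v \<in> M" "v' \<in> M" "{v, v'} \<in> edges G"
      using adj_commute by (auto simp: M_def adj_def)
    then show "v \<in> \<Union>P" by (auto simp: P_def)
  qed (auto simp: P_def)
  have disj: "e \<inter> e' = {}" if e: "e \<in> P" "e' \<in> P" "e \<noteq> e'" for e e'
  proof (rule ccontr)
    assume "e \<inter> e' \<noteq> {}"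
    then obtain v where v: "v \<in> e" "v \<in> e'" by auto
    then obtain y z where "e = {v, y}" "e' = {v, z}"
      using cardP[OF e(1)] cardP[OF e(2)] by (auto simp: card_2_iff)
    then show False
      using e N_degree[of v y z] subsets by (auto simp: P_def adj_def)
  qed
  define t where "t = card P"
  have card: "2 * t = card M"
    using card_partition[of P 2] finP U disj cardP finite_subsets by (simp add: t_def)
  obtain h where h: "bij_betw h {..<t} P"
    using ex_bij_betw_nat_finite[OF finP] by (auto simp: atLeast0LessThan t_def)
  have "\<forall>i\<in>{..<t}. \<exists>y z. h i = {y, z}"
    using cardP bij_betwE[OF h] by (metis card_2_iff)
  then obtain p q where pq: "\<And>i. i < t \<Longrightarrow> h i = {p i, q i}"
    by (metis lessThan_iff)
  have hP: "h i \<in> P" if "i < t" for i using bij_betwE[OF h] that by auto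
  have neq: "p i \<noteq> q i" if "i < t" for i
    using cardP[OF hP[OF that]] pq[OF that] by auto
  have ij: "i = j" if "i < t" "j < t" "h i \<inter> h j \<noteq> {}" for i j
    using that disj hP h by (metis bij_betw_imp_inj_on inj_onD lessThan_iff)
  show ?thesis
  proof (rule that[of t p q])
    show "card M = 2 * t" using card by simp
    have "M = \<Union>(h ` {..<t})" using U bij_betw_imp_surj_on[OF h] by simp
    also have "\<dots> = p ` {..<t} \<union> q ` {..<t}" using pq by auto
    finally show "M = p ` {..<t} \<union> q ` {..<t}" .
    show "inj_on p {..<t}" "inj_on q {..<t}"
      using ij pq by (auto intro!: inj_onI)
    show "p ` {..<t} \<inter> q ` {..<t} = {}"
    proof (rule ccontr)
      assume "p ` {..<t} \<inter> q ` {..<t} \<noteq> {}"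
      then obtain i j where "i < t" "j < t" "p i = q j" by auto
      then show False using ij[of i j] pq neq by auto
    qed
    show "adj (p i) (q i)" if "i < t" for i
      using hP[OF that] pq[OF that] by (simp add: P_def adj_def)
  qed
qed

lemma even_card_M: "even (card M)"
proof -
  have "\<exists>t. card M = 2 * t" using M_matching by metis
  then show ?thesis by auto
qed

lemma fan_iso:
  assumes W: "W = {}" and t: "card M = 2 * t" and k: "card N = 2 * t + k"
  shows "G \<simeq> fan t k"
proof (rule graph_iso_sym)
  obtain t' p q where t': "card M = 2 * t'" and pq: "M = p ` {..<t'} \<union> q ` {..<t'}"
    "inj_on p {..<t'}" "inj_on q {..<t'}" "p ` {..<t'} \<inter> q ` {..<t'} = {}"
    "\<And>i. i < t' \<Longrightarrow> adj (p i) (q i)"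
    using M_matching by blast
  have "t' = t" using t t' by simp
  note pq = pq[unfolded this]
  have "card (N - M) = k"
    using k t finite_subsets subsets by (simp add: card_Diff_subset)
  then obtain s where s: "bij_betw s {..<k} (N - M)"
    using ex_bij_betw_nat_finite[of "N - M"] finite_subsets by (auto simp: atLeast0LessThan)
  have sN: "s i \<in> N" "s i \<notin> M" if "i < k" for i
    using bij_betwE[OF s] that by auto
  have pqM: "p i \<in> M" "q i \<in> M" if "i < t" for i
    using pq(1) that by auto
  have pqN: "p i \<in> N" "q i \<in> N" if "i < t" for i
    using pqM[OF that] subsets by auto
  have V: "V = insert u N" "u \<notin> N"
    using W u subsets adj_irrefl[of u] by (auto simp: W_def N_def)
  have inj: "p i = p j \<longleftrightarrow> i = j" "q i = q j \<longleftrightarrow> i = j" "p i \<noteq> q j" "q i \<noteq> p j"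
    if "i < t" "j < t" for i j
    using that pq(2-4) by (auto simp: inj_on_def)
  have adj_pq: "adj (p i) z \<longleftrightarrow> z = q i" "adj (q i) z \<longleftrightarrow> z = p i" if "i < t" "z \<in> N" for i z
    using that pq(5)[OF that(1)] pqN[OF that(1)] N_degree[of "p i" "q i" z] N_degree[of "q i" "p i" z]
      adj_commute[of "p i" "q i"] by auto
  have adj_s: "\<not> adj (s i) z" if "i < k" "z \<in> N" for i z
    using sN[OF that(1)] that(2) by (auto simp: M_def)
  have adj_u: "adj u z" "adj z u" "z \<noteq> u" "u \<noteq> z" if "z \<in> N" for z
    using that V(2) adj_commute[of u z] by (auto simp: N_def)
  \<comment> \<open>In the i-th K_2 the vertex 0 goes to p i and the vertex 1 to q i; the unmatched
    neighbours s i are the pendant vertices.\<close>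
  define f :: "nat + (nat \<times> nat + nat \<times> nat) \<Rightarrow> 'a" where
    "f = case_sum (\<lambda>_. u) (case_sum (\<lambda>(i, j). if j = 0 then p i else q i) (\<lambda>(i, j). s i))"
  have f: "f (Inl i) = u" "f (Inr (Inl (i, j))) = (if j = 0 then p i else q i)"
    "f (Inr (Inr (i, j))) = s i" for i j
    by (simp_all add: f_def)
  have Vfan: "verts (fan t k) = Inl ` {0} \<union>
      ((\<lambda>i. Inr (Inl (i, 0))) ` {..<t} \<union> (\<lambda>i. Inr (Inl (i, 1))) ` {..<t}
      \<union> (\<lambda>i. Inr (Inr (i, 0))) ` {..<k})"
    by (auto simp: verts_simps lessThan_Suc numeral_2_eq_2 image_iff)
  have "f ` verts (fan t k) = insert u (p ` {..<t} \<union> q ` {..<t} \<union> s ` {..<k})"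
    unfolding Vfan image_Un image_image f by simp
  also have "\<dots> = V"
    using pq(1) bij_betw_imp_surj_on[OF s] subsets V by auto
  finally have surj: "f ` verts (fan t k) = V" .
  have s_inj: "s i = s j \<longleftrightarrow> i = j" if "i < k" "j < k" for i j
    using s that by (auto simp: bij_betw_def inj_on_def)
  have s_pq: "s i \<noteq> p j" "s i \<noteq> q j" "p j \<noteq> s i" "q j \<noteq> s i" if "i < k" "j < t" for i j
    using sN[OF that(1)] pqM[OF that(2)] by auto
  have "inj_on f (verts (fan t k))"
    unfolding Vfan by (rule inj_onI) (auto simp: f inj s_inj s_pq adj_u pqN sN)
  moreover have "{v, w} \<in> edges (fan t k) \<longleftrightarrow> {f v, f w} \<in> edges G"
    if "v \<in> verts (fan t k)" "w \<in> verts (fan t k)" for v w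
    unfolding adj_def[symmetric] using that unfolding Vfan
    by (auto simp: f edges_simps singleton_edges_simps verts_simps adj_u pqN sN adj_pq adj_s adj_irrefl inj s_pq)
  ultimately show "fan t k \<simeq> G"
    using surj unfolding graph_iso_def bij_betw_def by blast
qed

text \<open>The classes are \<open>insert u W\<close> and \<open>N\<close>, since u too has
  neighbourhood \<open>N\<close>. Both orders are provided because either class may be the small
  one.\<close>

lemma bipartite_case:
  assumes M: "M = {}" and W: "\<And>w v. w \<in> W \<Longrightarrow> v \<in> V \<Longrightarrow> adj w v \<longleftrightarrow> v \<in> N"
  obtains c d where "c * d = card (edges G)" "c \<le> 2 \<or> d \<le> 2"
    "G \<simeq> complete_bipartite c d" "G \<simeq> complete_bipartite d c"
proof -
  define X where "X = insert u W"
  have V: "V = X \<union> N" "X \<inter> N = {}" "finite X" "u \<notin> W"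
    using u subsets finite_subsets adj_irrefl[of u] by (auto simp: X_def W_def N_def)
  have X: "adj w v \<longleftrightarrow> v \<in> N" if "w \<in> X" "v \<in> V" for w v
    using that W by (auto simp: X_def N_def)
  have N: "adj v w \<longleftrightarrow> w \<in> X" if "v \<in> N" "w \<in> V" for v w
    using that X[of w v] adj_commute[of v w] M V subsets by (auto simp: M_def)
  have iso: "G \<simeq> complete_bipartite (card X) (card N)" "G \<simeq> complete_bipartite (card N) (card X)"
    by (rule complete_bipartite_iso;
        use V finite_subsets X N in \<open>auto simp: adj_def[symmetric]\<close>)+
  have "dN w = card N" if "w \<in> W" for w
    using N[of _ w] that subsets by (simp add: X_def subset_iff)
  moreover have "(\<Sum>w\<in>W. a v w) = 0" if "v \<in> W" for v
    using W[OF that] subsets by (intro sum.neutral) (auto simp: W_def)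
  ultimately have "real (card (edges G)) = card X * card N"
    using card_edges M V(4) finite_subsets by (simp add: e_W_def X_def algebra_simps)
  then have card: "card X * card N = card (edges G)"
    by (metis of_nat_eq_iff of_nat_mult)
  have "card X \<le> 2 \<or> card N \<le> 2"
  proof (rule ccontr)
    assume "\<not> ?thesis"
    then obtain S T where "S \<subseteq> X" "card S = 3" "T \<subseteq> N" "card T = 3"
      using obtain_subset_with_card_n[of 3 X] obtain_subset_with_card_n[of 3 N]
      by (metis not_less_eq_eq numeral_2_eq_2 numeral_3_eq_3)
    moreover from this obtain s1 s2 s3 t1 t2 t3 where
      "S = {s1, s2, s3}" "distinct [s1, s2, s3]" "T = {t1, t2, t3}" "distinct [t1, t2, t3]"
      by (auto simp: card_3_iff)
    ultimately show False
      using no_complete_bipartite_3_3[of s1 s2 s3 t1 t2 t3] X V by blast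
  qed
  with that card iso show ?thesis by blast
qed

end

section \<open>The extremal graphs\<close>

text \<open>Here t is the number of triangles at a vertex u of maximal eigenvector weight. The
  statement hides u and leaves only arithmetic in r, m and t.\<close>

lemma chordless_structure:
  fixes G :: "'a sgraph"
  defines "m \<equiv> card (edges G)"
  assumes G: "simple_graph G" "isolate_free G" "\<not> contains_chorded_cycle G" "verts G \<noteq> {}"
    and r: "rho G > 7/3 \<or> (rho G > 2 \<and> m \<le> 4)"
  shows "\<exists>t. 3 * t \<le> m \<and> (rho G - 1) * ((rho G)\<^sup>2 - m) \<le> t * (3 - rho G) \<and>
    (t * (3 - rho G) \<le> (rho G - 1) * ((rho G)\<^sup>2 - m) \<longrightarrow>
      (t \<ge> 1 \<longrightarrow> G \<simeq> fan t (m - 3 * t)) \<and>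
      (t = 0 \<longrightarrow> (\<exists>c d. c * d = m \<and> (c \<le> 2 \<or> d \<le> 2) \<and>
        G \<simeq> complete_bipartite c d \<and> G \<simeq> complete_bipartite d c)))"
proof -
  obtain y where y: "\<And>v. 0 \<le> y v" "\<exists>v\<in>verts G. y v \<noteq> 0"
    "\<And>v. v \<in> verts G \<Longrightarrow> rho G * y v \<le> (\<Sum>w\<in>verts G. of_bool ({v, w} \<in> edges G) * y w)"
    using rho_subinvariant_vector[OF G(1,4)] by blast
  have fin: "finite (verts G)" using G(1) by (simp add: simple_graph_def)
  obtain u where u: "u \<in> verts G" "\<And>v. v \<in> verts G \<Longrightarrow> y v \<le> y u"
    using Max_in[of "y ` verts G"] Max_ge[of "y ` verts G"] fin G(4) by fastforce
  have pos: "y u > 0"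
    using y(1,2) u(2) by (metis antisym_conv3 leD less_eq_real_def)
  interpret subinvariant_graph G u "\<lambda>v. y v / y u" "rho G"
  proof unfold_locales
    fix v assume v: "v \<in> verts G"
    have "rho G * (y v / y u) = rho G * y v / y u" by simp
    also have "\<dots> \<le> (\<Sum>w\<in>verts G. of_bool ({v, w} \<in> edges G) * y w) / y u"
      using y(3)[OF v] pos by (intro divide_right_mono) auto
    also have "\<dots> = (\<Sum>w\<in>verts G. of_bool ({v, w} \<in> edges G) * (y w / y u))"
      by (simp add: sum_divide_distrib)
    finally show "rho G * (y v / y u) \<le>
        (\<Sum>w\<in>verts G. of_bool (chordless_graph.adj G v w) * (y w / y u))"
      using G by (simp add: chordless_graph.adj_def[OF chordless_graph.intro])
  next
    show "rho G > 7/3 \<or> (rho G > 2 \<and> card (edges G) \<le> 4)" using r by (simp add: m_def)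
    show "0 \<le> y v / y u" "y v / y u \<le> 1" if "v \<in> verts G" for v
      using y(1) u(2)[OF that] pos by simp_all
    show "\<not> contains_chorded_cycle G" "y u / y u = 1" using G(3) pos by simp_all
  qed (fact G(1) u(1))+
  obtain t where t: "card M = 2 * t"
    using even_card_M by (elim evenE)
  have "card M \<le> card N" using finite_subsets subsets by (intro card_mono) auto
  moreover have "(\<Sum>w\<in>W. dN w) \<ge> 0" "e_W \<ge> 0" by (simp_all add: e_W_def sum_nonneg)
  \<comment> \<open>At least 2t edges join u to \<open>N\<close>, and t more lie inside
    \<open>N\<close>.\<close>
  ultimately have "real (3 * t) \<le> real m" using card_edges t by (simp add: m_def)
  then have t3: "3 * t \<le> m" by linarith
  have "(rho G - 1) * (s1 + s2 + s3) \<ge> 0" using slack_nonneg r_gt_2 by simp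
  then have bound: "(rho G - 1) * ((rho G)\<^sup>2 - m) \<le> t * (3 - rho G)"
    using spectral_bound slack_nonneg(4) t by (simp add: m_def)
  have "(t \<ge> 1 \<longrightarrow> G \<simeq> fan t (m - 3 * t)) \<and>
      (t = 0 \<longrightarrow> (\<exists>c d. c * d = m \<and> (c \<le> 2 \<or> d \<le> 2) \<and>
        G \<simeq> complete_bipartite c d \<and> G \<simeq> complete_bipartite d c))"
    if "t * (3 - rho G) \<le> (rho G - 1) * ((rho G)\<^sup>2 - m)"
  proof -
    have eq: "card M / 2 * (3 - rho G) \<le> (rho G - 1) * ((rho G)\<^sup>2 - card (edges G))"
      using that t by (simp add: m_def)
    have "G \<simeq> fan t (m - 3 * t)" if "t \<ge> 1"
    proof -
      have W: "W = {}"
        using equality_case(2)[OF G(2) eq] t that by fastforce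
      then have "real m = card N + t" using card_edges t by (simp add: m_def e_W_def)
      then have "m = card N + t" by linarith
      then show ?thesis using t3 t W by (intro fan_iso) auto
    qed
    moreover have "\<exists>c d. c * d = m \<and> (c \<le> 2 \<or> d \<le> 2) \<and>
        G \<simeq> complete_bipartite c d \<and> G \<simeq> complete_bipartite d c" if "t = 0"
    proof -
      have "M = {}" using t that finite_subsets by simp
      from bipartite_case[OF this equality_case(1)[OF G(2) eq]] show ?thesis
        unfolding m_def by metis
    qed
    ultimately show ?thesis by blast
  qed
  with t3 bound show ?thesis by blast
qed

text \<open>Supplies the hypothesis on r of \<open>excess_estimate\<close>. The cubic is negative at
  7/3 for m from 5 to 8; for m = 4 it is positive there, so the smaller value 2 is used.\<close>

lemma theta_lower_bounds:
  assumes "4 \<le> m" "m \<le> 8"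
  shows "theta m > 7/3 \<or> (theta m > 2 \<and> m \<le> 4)"
proof -
  have "m \<in> {4, 5, 6, 7, 8}" using assms by auto
  then consider "m = 4" | "m \<in> {5, 6, 7, 8}" by auto
  then show ?thesis
  proof cases
    case 1
    then have "2 < theta m" by (intro less_theta) simp
    with 1 show ?thesis by simp
  next
    case 2
    then have "7/3 < theta m"
      by (intro less_theta) (auto simp: power2_eq_square power3_eq_cube)
    then show ?thesis by simp
  qed
qed

theorem theorem1p1:
  fixes G :: "'a sgraph" and m :: nat
  assumes "m \<ge> 4" and "simple_graph G" and "isolate_free G" and "card (edges G) = m"
  shows
    "(m \<le> 8 \<longrightarrow> (let t = m div 3 in
        rho G \<ge> theta m \<longrightarrow>
          contains_chorded_cycle G \<or>
          (m = 6 \<and> G \<simeq> graph_join (complete_graph 1) (copies t (complete_graph 2))) \<or>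
          (m \<in> {4, 5, 7, 8} \<and>
            G \<simeq> graph_join (complete_graph 1)
                  (disjoint_union (copies t (complete_graph 2))
                                  (copies (m - 3 * t) (complete_graph 1)))))) \<and>
     (m \<ge> 9 \<longrightarrow>
        rho G \<ge> sqrt (real m) \<longrightarrow>
          contains_chorded_cycle G \<or>
          (m = 9 \<and>
            (G \<simeq> graph_join (complete_graph 1) (copies 3 (complete_graph 2)) \<or>
             G \<simeq> graph_join (complete_graph 1)
                   (disjoint_union (copies 2 (complete_graph 2)) (copies 3 (complete_graph 1))) \<or>
             G \<simeq> graph_join (complete_graph 1)
                   (disjoint_union (complete_graph 2) (copies 6 (complete_graph 1))) \<or>
             G \<simeq> complete_bipartite 1 9)) \<or>
          (m \<ge> 10 \<and> G \<simeq> complete_bipartite 1 m) \<or>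
          (m \<ge> 10 \<and> even m \<and> G \<simeq> complete_bipartite 2 (m div 2)))"
proof (cases "contains_chorded_cycle G")
  case False
  have "edges G \<noteq> {}" using assms by auto
  then have "verts G \<noteq> {}"
    using assms(2) by (fastforce simp: simple_graph_def)
  define r where "r = rho G"
  note struct = chordless_structure[OF assms(2,3) False \<open>verts G \<noteq> {}\<close>, unfolded assms(4), folded r_def]
  have fan_0: "G \<simeq> graph_join (complete_graph 1) (copies t (complete_graph 2))" if "G \<simeq> fan t 0" for t
    by (rule graph_iso_trans[OF that graph_join_no_copies])
  have fan_1: "G \<simeq> graph_join (complete_graph 1) (disjoint_union (complete_graph 2) (copies k (complete_graph 1)))"
    if "G \<simeq> fan 1 k" for k
    by (rule graph_iso_trans[OF that graph_join_one_copy])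
  have "G \<simeq> fan (m div 3) (m - 3 * (m div 3))" if m: "m \<le> 8" and rho: "theta m \<le> rho G"
  proof -
    have r: "r > 7/3 \<or> (r > 2 \<and> m \<le> 4)"
      using theta_lower_bounds[OF assms(1) m] rho by (auto simp: r_def)
    then have r2: "r > 2" by auto
    obtain t where t: "3 * t \<le> m" "(r - 1) * (r\<^sup>2 - m) \<le> t * (3 - r)"
      "\<lbrakk>t * (3 - r) \<le> (r - 1) * (r\<^sup>2 - m); t \<ge> 1\<rbrakk> \<Longrightarrow> G \<simeq> fan t (m - 3 * t)"
      using struct[OF r] by blast
    let ?s = "real (m div 3)"
    have "\<not> r ^ 3 - r\<^sup>2 + (?s - m) * r + m - 3 * ?s < 0"
      using less_theta[of r m] rho by (auto simp: r_def)
    moreover have "r ^ 3 - r\<^sup>2 + (?s - m) * r + m - 3 * ?s = (r - 1) * (r\<^sup>2 - m) - ?s * (3 - r)"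
      by (simp add: algebra_simps power2_eq_square power3_eq_cube)
    ultimately have s: "?s * (3 - r) \<le> (r - 1) * (r\<^sup>2 - m)" by simp
    \<comment> \<open>From r = 3 on, r^2 exceeds m, so the left side of the bound is positive and
      the right side is not.\<close>
    have "r < 3"
    proof (rule ccontr)
      assume "\<not> r < 3"
      then have "3\<^sup>2 \<le> r\<^sup>2" by (intro power_mono) auto
      then have "(r - 1) * (r\<^sup>2 - m) > 0" using m r2 by (intro mult_pos_pos) auto
      moreover have "t * (3 - r) \<le> 0" using \<open>\<not> r < 3\<close> by (simp add: mult_nonneg_nonpos)
      ultimately show False using t(2) by linarith
    qed
    \<comment> \<open>Dividing by 3 - r > 0 bounds t below by the floor of m/3, and 3t \<le> m
      bounds it above.\<close>
    moreover have "?s * (3 - r) \<le> t * (3 - r)" using s t(2) by linarith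
    ultimately have "m div 3 \<le> t" by simp
    then have "t = m div 3" using t(1) by linarith
    with t(3) s assms(1) show ?thesis by simp
  qed
  note small = this
  have large: "(m = 9 \<and> (\<exists>t\<in>{1, 2, 3}. G \<simeq> fan t (9 - 3 * t))) \<or> G \<simeq> complete_bipartite 1 m \<or>
      (even m \<and> G \<simeq> complete_bipartite 2 (m div 2))"
    if m: "m \<ge> 9" and rho: "rho G \<ge> sqrt m"
  proof -
    have "sqrt (3\<^sup>2) \<le> sqrt m" using m by (intro real_sqrt_le_mono) simp
    then have r: "r \<ge> 3" using rho by (simp add: r_def)
    have "(sqrt m)\<^sup>2 \<le> r\<^sup>2" using rho by (intro power_mono) (auto simp: r_def)
    then have r_sq: "r\<^sup>2 \<ge> m" by simp
    obtain t where t: "3 * t \<le> m" "(r - 1) * (r\<^sup>2 - m) \<le> t * (3 - r)"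
      "\<lbrakk>t * (3 - r) \<le> (r - 1) * (r\<^sup>2 - m); t \<ge> 1\<rbrakk> \<Longrightarrow> G \<simeq> fan t (m - 3 * t)"
      "\<lbrakk>t * (3 - r) \<le> (r - 1) * (r\<^sup>2 - m); t = 0\<rbrakk> \<Longrightarrow>
        \<exists>c d. c * d = m \<and> (c \<le> 2 \<or> d \<le> 2) \<and> G \<simeq> complete_bipartite c d \<and> G \<simeq> complete_bipartite d c"
      using struct r by fastforce
    \<comment> \<open>As r is at least 3 and r^2 at least m, the left side is nonnegative and the
      right side nonpositive, so both are zero.\<close>
    have "(r - 1) * (r\<^sup>2 - m) \<ge> 0" "t * (3 - r) \<le> 0"
      using r r_sq by (simp_all add: mult_nonneg_nonpos)
    with t(2) have eq: "t * (3 - r) \<le> (r - 1) * (r\<^sup>2 - m)" "(r - 1) * (r\<^sup>2 - m) = 0" "t * (3 - r) = 0"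
      by linarith+
    show ?thesis
    proof (cases "t = 0")
      case True
      then obtain c d where cd: "c * d = m" "c \<le> 2 \<or> d \<le> 2"
        "G \<simeq> complete_bipartite c d" "G \<simeq> complete_bipartite d c"
        using t(4) eq by blast
      have "c * d > 0" using cd(1) m by linarith
      then have "c = 1 \<or> c = 2 \<or> d = 1 \<or> d = 2" using cd(2) by auto
      then show ?thesis using cd by auto
    next
      case False
      \<comment> \<open>With a triangle at u, the vanishing right side gives r = 3, and the
        vanishing left side then gives m = r^2 = 9.\<close>
      then have "r = 3" using eq by simp
      with eq have "m = 9" by simp
      moreover from this have "t \<in> {1, 2, 3}" using t(1) False by auto
      ultimately show ?thesis using t(3) eq False by auto
    qed
  qed
  have part1: "(m = 6 \<and> G \<simeq> graph_join (complete_graph 1) (copies (m div 3) (complete_graph 2))) \<or>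
      (m \<in> {4, 5, 7, 8} \<and> G \<simeq> fan (m div 3) (m - 3 * (m div 3)))"
    if "m \<le> 8" "theta m \<le> rho G"
  proof (cases "m = 6")
    case True
    then show ?thesis using small[OF that] fan_0[of 2] by simp
  next
    case False
    then have "m \<in> {4, 5, 7, 8}" using that assms(1) by auto
    then show ?thesis using small[OF that] by blast
  qed
  have part2: "(m = 9 \<and>
        (G \<simeq> graph_join (complete_graph 1) (copies 3 (complete_graph 2)) \<or> G \<simeq> fan 2 3 \<or>
         G \<simeq> graph_join (complete_graph 1)
           (disjoint_union (complete_graph 2) (copies 6 (complete_graph 1))) \<or>
         G \<simeq> complete_bipartite 1 9)) \<or>
      (m \<ge> 10 \<and> G \<simeq> complete_bipartite 1 m) \<or>
      (m \<ge> 10 \<and> even m \<and> G \<simeq> complete_bipartite 2 (m div 2))"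
    if "m \<ge> 9" "rho G \<ge> sqrt m"
  proof (cases "m = 9")
    case True
    \<comment> \<open>Nine is odd, so K_{2,m/2} drops out; the fans with three triangles and with
      one are rewritten to the forms in the theorem.\<close>
    then show ?thesis using large[OF that] fan_0[of 3] fan_1[of 6] by auto
  next
    case False
    then show ?thesis using large[OF that] that(1) by auto
  qed
  show ?thesis
    unfolding Let_def using part1 part2 by blast
qed (simp add: Let_def)

end
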